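(* Let $n,m\in\mathbb{N}$, let $f\in\mathcal{F}^n$ and let $C\subset\mathbb{R}^m$ be a non-empty closed convex set. Suppose there exist sequences of functions $f_k:\mathrm{dom}(f)\to\mathbb{R}$ and $g_k:\mathbb{R}^n\times C\to\mathbb{R}$ ($k\in\mathbb{N}$) such that (extending $f_k$ by $+\infty$ outside $\mathrm{dom}(f)$, and $g_k$ by $+\infty$ at points $(x,x^* )$ with $x^*\notin C$) the following hold: $f_k$ converges uniformly to $f$ on $\mathrm{dom}(f)$; for every $k\in\mathbb{N}$, $f_k\in\mathcal{F}^n$ and $g_k\in\mathcal{F}^{n,m}_{f_k}$ satisfies property (D3), the closed set linked to $g_k$ being $C$; and $g_k$ converges uniformly on $\mathbb{R}^n\times C$ to a function $g:\mathbb{R}^n\times C\to\mathbb{R}$. Then, extending $g$ to $\mathbb{R}^n\times\mathbb{R}^m$ by $g(x,x^* )=+\infty$ whenever $x^*\notin C$, one has $g\in\mathcal{F}^{n,m}_f$ and $g$ satisfies property (D3), with linked closed set $C$.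
   Context: $\overline{\mathbb{R}}=\mathbb{R}\cup\{-\infty,+\infty\}$. A non-negative function $g:\mathbb{R}^n\times\mathbb{R}^m\to\overline{\mathbb{R}}$ is a G-coupling function if there is a non-empty closed set $C\subset\mathbb{R}^m$ (the closed set linked to $g$) such that (D1) $g$ is real-valued on $\mathbb{R}^n\times C$ and $g(x,x^* )=+\infty$ for every $x\in\mathbb{R}^n$, $x^*\notin C$; (D2) $\inf_{x\in\mathbb{R}^n,\,x^*\in C}g(x,x^* )=0$. $\mathcal{F}^{n,m}$ is the set of all G-coupling functions $g:\mathbb{R}^n\times\mathbb{R}^m\to\overline{\mathbb{R}}$. Property (D3) of $g\in\mathcal{F}^{n,m}$ with linked set $C$: $C$ is convex and $g(x,\cdot):C\to\mathbb{R}$ is convex and lower semicontinuous for each $x\in\mathbb{R}^n$. A function with values in $\mathbb{R}\cup\{+\infty\}$ is proper if it is not identically $+\infty$; $\mathrm{dom}(f)=\{x: f(x)<+\infty\}$. $\mathcal{F}^n$ is the set of proper functions $f:\mathbb{R}^n\to\mathbb{R}\cup\{+\infty\}$ with $\inf f>-\infty$. For $f\in\mathcal{F}^n$ and $g\in\mathcal{F}^{n,m}$ with linked set $C$, define $f^g:C\to\mathbb{R}\cup\{+\infty\}$ by $f^g(x^* )=\sup_{x\in\mathbb{R}^n}\{g(x,x^* )-f(x)\}$, and $\gamma_{g,f}:\mathbb{R}^n\times\mathbb{R}^m\to\mathbb{R}\cup\{+\infty\}$ by $\gamma_{g,f}(x,x^* )=f(x)+f^g(x^* )$ if $x^*\in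 C$ and $+\infty$ otherwise. Finally $\mathcal{F}^{n,m}_f=\{g\in\mathcal{F}^{n,m}: f^g\text{ is proper and }\inf\gamma_{g,f}=0\}$. *)

theory Defs
  imports "HOL-Analysis.Analysis"
begin

text \<open>
  A partial function such as \<open>f\<^sup>g : C \<rightarrow> \<real> \<union> {+\<infinity>}\<close> is a total function in HOL of which only the
  values on the domain are ever used.
\<close>

definition proper_on :: "'a set \<Rightarrow> ('a \<Rightarrow> ereal) \<Rightarrow> bool"
  where "proper_on D f \<longleftrightarrow> (\<forall>x\<in>D. f x \<noteq> -\<infinity>) \<and> (\<exists>x\<in>D. f x \<noteq> \<infinity>)"

definition eff_dom :: "('a \<Rightarrow> ereal) \<Rightarrow> 'a set"
  where "eff_dom f = {x. f x < \<infinity>}"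

definition extend_infty :: "'a set \<Rightarrow> ('a \<Rightarrow> real) \<Rightarrow> 'a \<Rightarrow> ereal"
  where "extend_infty D f x = (if x \<in> D then ereal (f x) else \<infinity>)"

definition lsc_on :: "'a::topological_space set \<Rightarrow> ('a \<Rightarrow> ereal) \<Rightarrow> bool"
  where "lsc_on D f \<longleftrightarrow> (\<forall>x\<in>D. f x \<le> Liminf (at x within D) f)"

definition bdd_below_proper :: "(real^'n \<Rightarrow> ereal) set"
  where "bdd_below_proper = {f. proper_on UNIV f \<and> (INF x. f x) > -\<infinity>}"

definition linked_set :: "((real^'n) \<times> (real^'m) \<Rightarrow> ereal) \<Rightarrow> (real^'m) set \<Rightarrow> bool"
  where "linked_set g C \<longleftrightarrow>
    C \<noteq> {} \<and> closed C \<and>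
    (\<forall>x. \<forall>y\<in>C. \<bar>g (x, y)\<bar> \<noteq> \<infinity>) \<and>
    (\<forall>x y. y \<notin> C \<longrightarrow> g (x, y) = \<infinity>) \<and>
    (INF p\<in>UNIV \<times> C. g p) = 0"

definition G_coupling :: "((real^'n) \<times> (real^'m) \<Rightarrow> ereal) set"
  where "G_coupling = {g. (\<forall>p. 0 \<le> g p) \<and> (\<exists>C. linked_set g C)}"

text \<open>A function has at most one linked set, so one may speak of \<^emph>\<open>the\<close> linked set.\<close>

lemma linked_set_unique:
  assumes "linked_set g C" "linked_set g C'"
  shows "C = C'"
proof -
  have eq: "D = {y. g (0, y) \<noteq> \<infinity>}" if "linked_set g D" for D
  proof (rule set_eqI)
    fix y
    have fin: "\<forall>y\<in>D. \<bar>g (0, y)\<bar> \<noteq> \<infinity>" and inf: "\<forall>y. y \<notin> D \<longrightarrow> g (0, y) = \<infinity>"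
      using that by (simp_all add: linked_set_def)
    show "y \<in> D \<longleftrightarrow> y \<in> {y. g (0, y) \<noteq> \<infinity>}"
      using fin inf by (cases "y \<in> D") auto
  qed
  show ?thesis
    using eq[OF assms(1)] eq[OF assms(2)] by (rule trans[OF _ sym])
qed

definition convex_lsc_coupling ::
    "((real^'n) \<times> (real^'m) \<Rightarrow> ereal) \<Rightarrow> (real^'m) set \<Rightarrow> bool"
  where "convex_lsc_coupling g C \<longleftrightarrow>
    convex C \<and>
    (\<forall>x. convex_on C (\<lambda>y. real_of_ereal (g (x, y))) \<and> lsc_on C (\<lambda>y. g (x, y)))"

text \<open>The conjugate \<open>f\<^sup>g\<close>, meaningful only at points of the linked set of \<open>g\<close>: elsewhere \<open>\<infinity> - \<infinity>\<close> may occur.\<close>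

definition G_conj ::
    "((real^'n) \<times> (real^'m) \<Rightarrow> ereal) \<Rightarrow> (real^'n \<Rightarrow> ereal) \<Rightarrow> real^'m \<Rightarrow> ereal"
  where "G_conj g f y = (SUP x. g (x, y) - f x)"

definition gamma ::
    "(real^'m) set \<Rightarrow> ((real^'n) \<times> (real^'m) \<Rightarrow> ereal) \<Rightarrow> (real^'n \<Rightarrow> ereal)
      \<Rightarrow> (real^'n) \<times> (real^'m) \<Rightarrow> ereal"
  where "gamma C g f = (\<lambda>(x, y). if y \<in> C then f x + G_conj g f y else \<infinity>)"

definition G_coupling_for :: "(real^'n \<Rightarrow> ereal) \<Rightarrow> ((real^'n) \<times> (real^'m) \<Rightarrow> ereal) set"
  where "G_coupling_for f =
    {g \<in> G_coupling. \<exists>C. linked_set g C \<and> proper_on C (G_conj g f) \<and> (INF p. gamma C g f p) = 0}"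

end

theory Submission
  imports Defs
begin

text \<open>
  Write \<open>a \<approx>\<^sub>e b\<close> for \<open>a \<le> b + e \<and> b \<le> a + e\<close> in the extended reals. This relation
  survives suprema, infima and lower limits, so a uniform error \<open>e\<close> in both \<open>f\<close> and \<open>g\<close> causes an error
  of at most \<open>2e\<close> in \<open>f\<^sup>g\<close> and \<open>3e\<close> in \<open>\<gamma>\<close>. All conditions on the infima, properness and lower
  semicontinuity therefore pass to uniform limits; convexity passes to pointwise limits.
\<close>

text \<open>Two inequalities with added errors replace \<open>\<bar>a - b\<bar> \<le> e\<close>,
  because \<open>\<infinity> - \<infinity>\<close> is \<open>\<infinity>\<close> for extended reals,
  so an infinite value would not be near itself.\<close>

definition ereal_near :: "real \<Rightarrow> ereal \<Rightarrow> ereal \<Rightarrow> bool"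
  where "ereal_near e a b \<longleftrightarrow> a \<le> b + ereal e \<and> b \<le> a + ereal e"

lemma ereal_near_sym: "ereal_near e a b \<Longrightarrow> ereal_near e b a"
  by (simp add: ereal_near_def)

text \<open>No finiteness is required: addition of extended reals is total, commutative, associative
  and monotone, even where infinities of opposite sign meet.\<close>

lemma ereal_near_add:
  assumes "ereal_near d a a'" "ereal_near e b b'"
  shows "ereal_near (d + e) (a + b) (a' + b')"
proof -
  have "u + v \<le> u' + v' + ereal (d + e)" if "u \<le> u' + ereal d" "v \<le> v' + ereal e" for u v u' v'
    using add_mono[OF that] by (simp add: ac_simps flip: plus_ereal.simps(1))
  with assms show ?thesis
    by (simp add: ereal_near_def)
qed

lemma ereal_near_uminus:
  assumes "ereal_near e a b"
  shows "ereal_near e (- a) (- b)"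
  using assms by (cases a; cases b) (auto simp: ereal_near_def)

lemma ereal_near_minus:
  assumes "ereal_near d a a'" "ereal_near e b b'"
  shows "ereal_near (d + e) (a - b) (a' - b')"
  using ereal_near_add[OF assms(1) ereal_near_uminus[OF assms(2)]]
  by (simp add: minus_ereal_def)

lemma ereal_near_SUP:
  assumes "\<And>x. x \<in> A \<Longrightarrow> ereal_near e (u x) (v x)"
  shows "ereal_near e (SUP x\<in>A. u x) (SUP x\<in>A. v x)"
proof -
  have "(SUP x\<in>A. u x) \<le> (SUP x\<in>A. v x) + ereal e" if "\<And>x. x \<in> A \<Longrightarrow> u x \<le> v x + ereal e"
    for u v
    by (intro SUP_least order_trans[OF that] add_right_mono SUP_upper)
  with assms show ?thesis
    by (simp add: ereal_near_def)
qed

lemma ereal_near_INF: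
  assumes "\<And>x. x \<in> A \<Longrightarrow> ereal_near e (u x) (v x)"
  shows "ereal_near e (INF x\<in>A. u x) (INF x\<in>A. v x)"
proof -
  have "ereal_near e (SUP x\<in>A. - u x) (SUP x\<in>A. - v x)"
    by (intro ereal_near_SUP ereal_near_uminus assms)
  from ereal_near_uminus[OF this] show ?thesis
    by (simp add: ereal_INF_uminus_eq flip: ereal_INF_uminus_eq)
qed

text \<open>\<open>Liminf\<close> is by definition a supremum of infima, so the two preceding lemmas
  apply in turn without enlarging the error.\<close>

lemma ereal_near_Liminf:
  assumes "\<And>x. ereal_near e (u x) (v x)"
  shows "ereal_near e (Liminf F u) (Liminf F v)"
  unfolding Liminf_def by (intro ereal_near_SUP ereal_near_INF assms)

lemma ereal_near_infty_iff:
  assumes "ereal_near e a b"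
  shows "a = \<infinity> \<longleftrightarrow> b = \<infinity>" "a = -\<infinity> \<longleftrightarrow> b = -\<infinity>"
  using assms by (cases a; cases b; auto simp: ereal_near_def)+

text \<open>Passage to the limit in an inequality. The approximants may change with
  \<open>e\<close>, and the factors \<open>c\<close> and \<open>d\<close> absorb errors that have
  accumulated to multiples of \<open>e\<close>.\<close>

lemma ereal_le_of_near:
  assumes "\<And>e. 0 < e \<Longrightarrow> \<exists>a' b'. ereal_near (c * e) a a' \<and> a' \<le> b' \<and> ereal_near (d * e) b b'"
    and "0 < c + d"
  shows "a \<le> b"
proof (rule ereal_le_epsilon2)
  fix e :: real
  assume "0 < e"
  \<comment> \<open>Scaled so that the two errors \<open>c * r\<close> and \<open>d * r\<close> add
    up to \<open>e\<close>.\<close>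
  define r where "r = e / (c + d)"
  have "0 < r" using \<open>0 < e\<close> assms(2) by (simp add: r_def)
  then obtain a' b' where near: "ereal_near (c * r) a a'" "a' \<le> b'" "ereal_near (d * r) b b'"
    using assms(1) by blast
  have "a \<le> b' + ereal (c * r)"
    using near(1,2) by (meson add_right_mono ereal_near_def order_trans)
  also have "\<dots> \<le> b + ereal (d * r) + ereal (c * r)"
    using near(3) by (auto simp: ereal_near_def intro: add_right_mono)
  also have "\<dots> = b + ereal ((c + d) * r)"
    by (simp add: add.assoc algebra_simps)
  also have "(c + d) * r = e"
    using assms(2) by (simp add: r_def)
  finally show "a \<le> b + ereal e" .
qed

lemma ereal_eq_of_near:
  assumes near: "\<And>e. 0 < e \<Longrightarrow> ereal_near (c * e) a b" and "0 < c"
  shows "a = b"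
proof (rule antisym)
  have self: "ereal_near (0 * e) x x" for e x
    by (simp add: ereal_near_def)
  show "a \<le> b"
    by (rule ereal_le_of_near[where c = c and d = 0]) (use near self \<open>0 < c\<close> in force)+
  show "b \<le> a"
    by (rule ereal_le_of_near[where c = c and d = 0])
      (use ereal_near_sym[OF near] self \<open>0 < c\<close> in force)+
qed

text \<open>Off \<open>D\<close> both extensions are \<open>\<infinity>\<close>, so an estimate on
  \<open>D\<close> becomes one at every point and later arguments need no domain conditions.\<close>

lemma ereal_near_extend_infty:
  assumes "\<And>x. x \<in> D \<Longrightarrow> dist (u x) (v x) < e"
  shows "ereal_near e (extend_infty D u x) (extend_infty D v x)"
  using assms[of x] by (auto simp: ereal_near_def extend_infty_def dist_real_def)

text \<open>Puts \<open>f\<close> in the same form as its approximants. The value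
  \<open>-\<infinity>\<close> must be excluded: it lies in the effective domain, but
  \<open>real_of_ereal\<close> sends it to 0.\<close>

lemma extend_infty_eff_dom:
  assumes "\<And>x. f x \<noteq> -\<infinity>"
  shows "extend_infty (eff_dom f) (\<lambda>x. real_of_ereal (f x)) = f"
proof
  fix x
  show "extend_infty (eff_dom f) (\<lambda>x. real_of_ereal (f x)) x = f x"
    using assms[of x] by (cases "f x") (auto simp: extend_infty_def eff_dom_def)
qed

lemma ereal_near_G_conj:
  assumes "\<And>p. ereal_near d (g p) (g' p)" "\<And>x. ereal_near e (f x) (f' x)"
  shows "ereal_near (d + e) (G_conj g f y) (G_conj g' f' y)"
  unfolding G_conj_def by (intro ereal_near_SUP ereal_near_minus assms)

lemma ereal_near_gamma:
  assumes "\<And>p. ereal_near d (g p) (g' p)" "\<And>x. ereal_near e (f x) (f' x)"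
  shows "ereal_near (e + (d + e)) (gamma C g f p) (gamma C g' f' p)"
  using ereal_near_add[OF assms(2) ereal_near_G_conj[of d g g' e f f', OF assms]]
  by (cases p) (auto simp: gamma_def ereal_near_def[of _ "\<infinity>" "\<infinity>"])

text \<open>One fixed error \<open>e\<close>, however large, suffices: near values are infinite at
  the same points and with the same sign.\<close>

lemma proper_on_near:
  assumes "proper_on D u" "\<And>x. ereal_near e (u x) (v x)"
  shows "proper_on D v"
  using assms(1) ereal_near_infty_iff[OF assms(2)] by (simp add: proper_on_def)

text \<open>One error \<open>e\<close> arises in replacing \<open>u x\<close> by \<open>v x\<close>
  and another in returning from the lower limit of \<open>v\<close> to that of \<open>u\<close>;
  their sum is arbitrarily small.\<close>

lemma lsc_on_of_near:
  assumes "\<And>e. 0 < e \<Longrightarrow> \<exists>v. lsc_on D v \<and> (\<forall>x. ereal_near e (u x) (v x))"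
  shows "lsc_on D u"
  unfolding lsc_on_def
proof
  fix x
  assume "x \<in> D"
  show "u x \<le> Liminf (at x within D) u"
  proof (rule ereal_le_of_near[where c = 1 and d = 1])
    fix e :: real
    assume "0 < e"
    then obtain v where "lsc_on D v" "\<forall>x. ereal_near e (u x) (v x)"
      using assms by blast
    then have "ereal_near e (u x) (v x)" "v x \<le> Liminf (at x within D) v"
        "ereal_near e (Liminf (at x within D) u) (Liminf (at x within D) v)"
      using \<open>x \<in> D\<close> by (auto simp: lsc_on_def intro: ereal_near_Liminf)
    then show "\<exists>a' b'. ereal_near (1 * e) (u x) a' \<and> a' \<le> b'
        \<and> ereal_near (1 * e) (Liminf (at x within D) u) b'"
      unfolding mult_1 by blast
  qed simp
qed

lemma convex_on_pointwise_limit: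
  fixes u :: "'a::real_vector \<Rightarrow> real"
  assumes "convex C" "\<And>k. convex_on C (v k)" "\<And>y. y \<in> C \<Longrightarrow> (\<lambda>k. v k y) \<longlonglongrightarrow> u y"
  shows "convex_on C u"
proof (rule convex_onI)
  fix t :: real and x y
  assume t: "0 < t" "t < 1" and xy: "x \<in> C" "y \<in> C"
  \<comment> \<open>Convergence is known only on \<open>C\<close>, so the convex combination has to
    lie there.\<close>
  have mem: "(1 - t) *\<^sub>R x + t *\<^sub>R y \<in> C"
    using convexD_alt[OF assms(1) xy] t by simp
  show "u ((1 - t) *\<^sub>R x + t *\<^sub>R y) \<le> (1 - t) * u x + t * u y"
  proof (rule LIMSEQ_le)
    show "(\<lambda>k. v k ((1 - t) *\<^sub>R x + t *\<^sub>R y)) \<longlonglongrightarrow> u ((1 - t) *\<^sub>R x + t *\<^sub>R y)"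
      by (rule assms(3)[OF mem])
    show "(\<lambda>k. (1 - t) * v k x + t * v k y) \<longlonglongrightarrow> (1 - t) * u x + t * u y"
      by (intro tendsto_intros assms(3) xy)
    show "\<exists>N. \<forall>k\<ge>N. v k ((1 - t) *\<^sub>R x + t *\<^sub>R y) \<le> (1 - t) * v k x + t * v k y"
      using convex_onD[OF assms(2)] t xy by auto
  qed
qed (fact assms(1))

theorem theorem3p6:
  fixes f :: "real^'n \<Rightarrow> ereal"
    and C :: "(real^'m) set"
    and fk :: "nat \<Rightarrow> real^'n \<Rightarrow> real"
    and gk :: "nat \<Rightarrow> (real^'n) \<times> (real^'m) \<Rightarrow> real"
    and g :: "(real^'n) \<times> (real^'m) \<Rightarrow> real"
  assumes "f \<in> bdd_below_proper"
    and "C \<noteq> {}" and "closed C" and "convex C"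
    and "uniform_limit (eff_dom f) fk (\<lambda>x. real_of_ereal (f x)) sequentially"
    and "\<And>k. extend_infty (eff_dom f) (fk k) \<in> bdd_below_proper"
    and "\<And>k. extend_infty (UNIV \<times> C) (gk k) \<in> G_coupling_for (extend_infty (eff_dom f) (fk k))"
    and "\<And>k. linked_set (extend_infty (UNIV \<times> C) (gk k)) C"
    and "\<And>k. convex_lsc_coupling (extend_infty (UNIV \<times> C) (gk k)) C"
    and "uniform_limit (UNIV \<times> C) gk g sequentially"
  shows "extend_infty (UNIV \<times> C) g \<in> G_coupling_for f
    \<and> linked_set (extend_infty (UNIV \<times> C) g) C
    \<and> convex_lsc_coupling (extend_infty (UNIV \<times> C) g) C"
proof -
  define fE where "fE k = extend_infty (eff_dom f) (fk k)" for k
  define gE where "gE k = extend_infty (UNIV \<times> C) (gk k)" for k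
  define G where "G = extend_infty (UNIV \<times> C) g"
  have f_eq: "extend_infty (eff_dom f) (\<lambda>x. real_of_ereal (f x)) = f"
    using assms(1) by (intro extend_infty_eff_dom) (simp add: bdd_below_proper_def proper_on_def)
  \<comment> \<open>A single index \<open>k\<close> serves both uniform limits, and the estimates
    hold at all points, including those where the extensions are \<open>\<infinity>\<close>.\<close>
  have near: "\<exists>k. (\<forall>p. ereal_near e (G p) (gE k p)) \<and> (\<forall>x. ereal_near e (f x) (fE k x))"
    if "0 < e" for e
  proof -
    have "\<forall>\<^sub>F k in sequentially. (\<forall>x\<in>eff_dom f. dist (fk k x) (real_of_ereal (f x)) < e)
        \<and> (\<forall>p\<in>UNIV \<times> C. dist (gk k p) (g p) < e)"
      by (intro eventually_conj uniform_limitD assms(5,10) that)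
    then obtain k where k: "\<forall>x\<in>eff_dom f. dist (fk k x) (real_of_ereal (f x)) < e"
        "\<forall>p\<in>UNIV \<times> C. dist (gk k p) (g p) < e"
      using eventually_happens'[OF sequentially_bot] by blast
    have "ereal_near e (gE k p) (G p)" for p
      unfolding gE_def G_def by (rule ereal_near_extend_infty) (use k(2) in blast)
    moreover have "ereal_near e (fE k x) (f x)" for x
      unfolding fE_def by (subst f_eq[symmetric], rule ereal_near_extend_infty) (use k(1) in blast)
    ultimately show ?thesis
      by (meson ereal_near_sym)
  qed
  have linked_k: "linked_set (gE k) C" for k
    using assms(8) by (simp add: gE_def)
  \<comment> \<open>Membership in \<open>G_coupling_for\<close> provides only some linked set;
    \<open>linked_set_unique\<close> identifies it with \<open>C\<close>.\<close>
  have coupling_k: "0 \<le> gE k p" "proper_on C (G_conj (gE k) (fE k))"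
      "(INF p. gamma C (gE k) (fE k) p) = 0" for k p
    using assms(7)[of k] linked_set_unique[OF _ linked_k[of k]]
    by (cases p; auto simp: G_coupling_for_def G_coupling_def gE_def[symmetric] fE_def[symmetric])+
  have gk_lim: "(\<lambda>k. gk k (x, y)) \<longlonglongrightarrow> g (x, y)" if "y \<in> C" for x y
    using tendsto_uniform_limitI[OF assms(10)] that by simp

  have nonneg: "0 \<le> G p" for p
  proof (cases "p \<in> UNIV \<times> C")
    case True
    have "0 \<le> gk k p" for k
      using coupling_k(1)[of k p] True by (simp add: gE_def extend_infty_def)
    then have "0 \<le> g p"
      using gk_lim True by (cases p) (auto intro: LIMSEQ_le_const)
    then show ?thesis
      by (simp add: G_def extend_infty_def)
  qed (simp add: G_def extend_infty_def)

  have "(INF p\<in>UNIV \<times> C. G p) = 0"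
  proof (rule ereal_eq_of_near[where c = 1])
    fix e :: real
    assume "0 < e"
    then obtain k where "\<forall>p. ereal_near e (G p) (gE k p)"
      using near by blast
    then have "ereal_near e (INF p\<in>UNIV \<times> C. G p) (INF p\<in>UNIV \<times> C. gE k p)"
      by (intro ereal_near_INF) blast
    then show "ereal_near (1 * e) (INF p\<in>UNIV \<times> C. G p) 0"
      using linked_k[of k] by (simp add: linked_set_def)
  qed simp
  then have linked: "linked_set G C"
    using assms(2,3) by (auto simp: linked_set_def G_def extend_infty_def)

  have "(INF p. gamma C G f p) = 0"
  proof (rule ereal_eq_of_near[where c = 3])
    fix e :: real
    assume "0 < e"
    then obtain k where "\<forall>p. ereal_near e (G p) (gE k p)" "\<forall>x. ereal_near e (f x) (fE k x)"
      using near by blast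
    then have "ereal_near (e + (e + e)) (INF p. gamma C G f p) (INF p. gamma C (gE k) (fE k) p)"
      by (intro ereal_near_INF ereal_near_gamma) blast+
    then show "ereal_near (3 * e) (INF p. gamma C G f p) 0"
      by (simp add: coupling_k(3))
  qed simp
  moreover have "proper_on C (G_conj G f)"
  proof -
    \<comment> \<open>The error 1 is an arbitrary positive choice, as properness only concerns
      infinite values.\<close>
    obtain k where "\<forall>p. ereal_near 1 (G p) (gE k p)" "\<forall>x. ereal_near 1 (f x) (fE k x)"
      using near[of 1] by auto
    then have "ereal_near (1 + 1) (G_conj (gE k) (fE k) y) (G_conj G f y)" for y
      by (intro ereal_near_G_conj) (blast intro: ereal_near_sym)+
    then show ?thesis
      by (rule proper_on_near[OF coupling_k(2)])
  qed
  ultimately have "G \<in> G_coupling_for f"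
    using linked nonneg by (auto simp: G_coupling_for_def G_coupling_def)

  moreover have "convex_lsc_coupling G C"
    unfolding convex_lsc_coupling_def
  proof (intro conjI allI)
    fix x
    have conv_k: "convex_on C (\<lambda>y. real_of_ereal (gE k (x, y)))"
      and lsc_k: "lsc_on C (\<lambda>y. gE k (x, y))" for k
      using assms(9)[of k] by (simp_all add: convex_lsc_coupling_def gE_def)
    show "convex_on C (\<lambda>y. real_of_ereal (G (x, y)))"
      \<comment> \<open>On \<open>C\<close> the extensions are finite, so
        \<open>real_of_ereal\<close> recovers \<open>gk\<close> and \<open>g\<close>, and pointwise
        convergence is available from \<open>gk_lim\<close>.\<close>
      by (rule convex_on_pointwise_limit[where v = "\<lambda>k y. real_of_ereal (gE k (x, y))"])
        (use assms(4) conv_k in \<open>simp_all add: gE_def G_def extend_infty_def gk_lim\<close>)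
    show "lsc_on C (\<lambda>y. G (x, y))"
      by (rule lsc_on_of_near) (use near lsc_k in blast)
  qed (fact assms(4))
  ultimately show ?thesis
    using linked by (simp add: G_def)
qed

end
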